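(* There is a universal constant $C$ such that for every integer $n\geq2$, with $K$ a random variable on $\{1,\dots,n\}$ with $\mathbb{P}[K=k]=\pi(k)=N(n,k)/C_n$, $$\sigma_n^{1/2}\,\sup_{k\in\mathbb{Z}}\left|\mathbb{P}[K=k]-\frac{1}{\sigma_n}\varphi\left(\frac{k-\mu_n}{\sigma_n}\right)\right|\leq\frac{C}{n^{1/2}},$$ where $\varphi$ is the standard normal density.
   Context: Narayana numbers: $N(n,k)=\frac1n\binom{n}{k-1}\binom{n}{k}$ for $1\le k\le n$. Catalan numbers: $C_n=\frac{1}{n+1}\binom{2n}{n}=\sum_{k=1}^n N(n,k)$. Thus $\pi(k)=N(n,k)/C_n$ is a probability distribution on $\{1,\dots,n\}$. Furthermore $\mu_n=\frac{n+1}{2}$, $\sigma_n^2=\frac{(n-1)(n+1)}{4(2n-1)}$ and $\sigma_n>0$. *)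

theory Defs
  imports "HOL-Probability.Probability"
begin

definition narayana :: "nat \<Rightarrow> nat \<Rightarrow> real" where
  "narayana n k = 1 / real n * real (n choose (k - 1)) * real (n choose k)"

definition catalan :: "nat \<Rightarrow> real" where
  "catalan n = 1 / (real n + 1) * real ((2 * n) choose n)"

(* The truncated k - 1 in narayana gives a junk value at k = 0, so the mass function restricts k
   to {1..n} explicitly.  The law lives on int because the local limit error is measured over
   all integers. *)
definition narayana_mass :: "nat \<Rightarrow> int \<Rightarrow> real" where
  "narayana_mass n k = (if 1 \<le> k \<and> k \<le> int n then narayana n (nat k) / catalan n else 0)"

definition narayana_pmf :: "nat \<Rightarrow> int pmf" where
  "narayana_pmf n = embed_pmf (narayana_mass n)"

definition narayana_mean :: "nat \<Rightarrow> real" where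
  "narayana_mean n = (real n + 1) / 2"

definition narayana_sd :: "nat \<Rightarrow> real" where
  "narayana_sd n = sqrt ((real n - 1) * (real n + 1) / (4 * (2 * real n - 1)))"

lemma catalan_pos: "catalan n > 0"
  by (simp add: catalan_def)

lemma narayana_mass_nonneg: "narayana_mass n k \<ge> 0"
  using catalan_pos[of n] by (simp add: narayana_mass_def narayana_def)

lemma sum_narayana:
  assumes "n \<ge> 1"
  shows "(\<Sum>k = 1..n. narayana n k) = catalan n"
proof -
  obtain m where n: "n = Suc m"
    using assms by (cases n) auto
  have "(\<Sum>k = 1..n. (n choose (k - 1)) * (n choose k)) = (\<Sum>j\<le>m. (n choose j) * (n choose Suc j))"
    unfolding n by (rule sum.reindex_bij_witness[of _ Suc "\<lambda>k. k - 1"]) auto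
  also have "\<dots> = (\<Sum>j\<le>m. (n choose j) * (n choose (m - j)))"
  proof (rule sum.cong)
    fix j assume "j \<in> {..m}"
    then show "(n choose j) * (n choose Suc j) = (n choose j) * (n choose (m - j))"
      using binomial_symmetric[of "Suc j" n] by (simp add: n)
  qed simp
  also have "\<dots> = (n + n) choose m"
    by (rule vandermonde)
  finally have sum_eq: "(\<Sum>k = 1..n. (n choose (k - 1)) * (n choose k)) = (2 * n) choose m"
    by (simp add: mult_2)
  have "Suc m * ((2 * n) choose Suc m) = (2 * n - m) * ((2 * n) choose m)"
    using binomial_absorb_comp[of "2 * n" m] binomial_absorption[of m "2 * n"] by simp
  then have "n * ((2 * n) choose n) = (n + 1) * ((2 * n) choose m)"
    by (simp add: n)
  then have "real n * real ((2 * n) choose n) = (real n + 1) * real ((2 * n) choose m)"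
    by (metis of_nat_1 of_nat_add of_nat_mult)
  then have "real ((2 * n) choose m) / real n = catalan n"
    using assms by (simp add: catalan_def field_simps)
  moreover have "(\<Sum>k = 1..n. narayana n k) =
      real (\<Sum>k = 1..n. (n choose (k - 1)) * (n choose k)) / real n"
    by (simp add: narayana_def sum_divide_distrib)
  ultimately show ?thesis
    by (simp only: sum_eq)
qed

lemma pmf_narayana_pmf:
  assumes "n \<ge> 1"
  shows "pmf (narayana_pmf n) k = narayana_mass n k"
  unfolding narayana_pmf_def
proof (rule pmf_embed_pmf)
  have "(\<integral>\<^sup>+ k. ennreal (narayana_mass n k) \<partial>count_space UNIV) =
      (\<Sum>k\<in>{1..int n}. ennreal (narayana_mass n k))"
    by (rule nn_integral_count_space') (auto simp: narayana_mass_def)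
  also have "\<dots> = ennreal (\<Sum>k\<in>{1..int n}. narayana_mass n k)"
    by (simp add: narayana_mass_nonneg sum_ennreal)
  also have "(\<Sum>k\<in>{1..int n}. narayana_mass n k) = (\<Sum>k = 1..n. narayana n k / catalan n)"
    by (rule sum.reindex_bij_witness[of _ int nat]) (auto simp: narayana_mass_def)
  also have "\<dots> = 1"
    using sum_narayana[OF assms] catalan_pos[of n] by (simp flip: sum_divide_distrib)
  finally show "(\<integral>\<^sup>+ k. ennreal (narayana_mass n k) \<partial>count_space UNIV) = 1"
    by simp
qed (rule narayana_mass_nonneg)

end

theory Submission
  imports Defs "HOL-Real_Asymp.Real_Asymp"
begin

text \<open>
  By symmetry only \<open>k \<ge> \<mu>\<close> matters.  Compare the mass function \<open>p\<close> with the Gaussian \<open>g\<close> of the same mean and variance through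
  \<open>q = p / g\<close>.  With \<open>x = k - n / 2\<close> one has exactly \<open>p (k + 1) / p k = (1 - t) / (1 + t)\<close>, where
  \<open>t = (n + 1) x / (n (n + 2) / 4 + x\<^sup>2)\<close>, and \<open>g (k + 1) / g k = exp (- x / \<sigma>\<^sup>2)\<close>, so
  \<open>ln q\<close> changes by only \<open>O(x / n\<^sup>2 + x\<^sup>3 / n\<^sup>3)\<close> per step.  At the centre \<open>ln q\<close> is small
  by Wallis' product.  Telescoping over \<open>L \<approx> n powr (5/8)\<close> steps gives \<open>ln q = O(n powr (-1/2))\<close>
  there; beyond that both \<open>p\<close> and \<open>g\<close> are decreasing, and \<open>g\<close> is already smaller than its
  maximum by the factor \<open>exp (- L\<^sup>2 / (2 \<sigma>\<^sup>2)) \<le> 2 \<sigma>\<^sup>2 / L\<^sup>2 = O(n powr (-1/4))\<close>, which is all that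
  the claim requires.
\<close>

section \<open>Central binomial coefficients and Wallis' product\<close>

text \<open>The probability of \<open>m\<close> heads in \<open>2 * m\<close> fair tosses. With this
  scaling the powers of 4 cancel when the mass at the centre is expressed through it.\<close>

definition central_mass :: "nat \<Rightarrow> real" where
  "central_mass m = real ((2 * m) choose m) / 4 ^ m"

lemma central_mass_pos: "central_mass m > 0"
  by (simp add: central_mass_def)

lemma central_mass_Suc:
  "central_mass (Suc m) = central_mass m * (2 * real m + 1) / (2 * real m + 2)"
proof -
  have "Suc m * ((2 * Suc m) choose Suc m) = (2 * Suc m) * ((2 * m + 1) choose m)"
    using binomial_absorption[of m "2 * Suc m"] by simp
  then have 1: "(2 * Suc m) choose Suc m = 2 * ((2 * m + 1) choose m)"
    by (metis Suc_neq_Zero mult.assoc mult.commute mult_cancel1)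
  have "(m + 1) * ((2 * m + 1) choose m) = (2 * m + 1) * ((2 * m) choose m)"
    using binomial_absorb_comp[of "2 * m + 1" m] by simp
  then have "real ((m + 1) * ((2 * m + 1) choose m)) = real ((2 * m + 1) * ((2 * m) choose m))"
    by (simp only:)
  then have "(real m + 1) * real ((2 * m + 1) choose m) = (2 * real m + 1) * real ((2 * m) choose m)"
    by (simp only: of_nat_mult of_nat_add of_nat_1 of_nat_numeral)
  then have "real ((2 * m + 1) choose m) = (2 * real m + 1) * real ((2 * m) choose m) / (real m + 1)"
    by (simp add: field_simps)
  then show ?thesis
    unfolding central_mass_def 1 of_nat_mult by (simp add: divide_simps) (simp add: algebra_simps)
qed

text \<open>Passing to \<open>Suc m\<close> multiplies the first two factors by
  \<open>(2m+1)(2m+3) / (2m+2)^2\<close> and the partial Wallis product by the inverse of this,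
  since \<open>4(m+1)^2 - 1 = (2m+1)(2m+3)\<close>.\<close>

lemma central_mass_sq_wallis:
  "(central_mass m)\<^sup>2 * (2 * real m + 1) * (\<Prod>k=1..m. (4 * (real k)\<^sup>2) / (4 * (real k)\<^sup>2 - 1)) = 1"
proof (induction m)
  case 0
  show ?case by (simp add: central_mass_def)
next
  case (Suc m)
  define P where "P = (\<Prod>k=1..m. (4 * (real k)\<^sup>2) / (4 * (real k)\<^sup>2 - 1))"
  have "(central_mass (Suc m))\<^sup>2 * (2 * real (Suc m) + 1) *
      (P * ((4 * (real (Suc m))\<^sup>2) / (4 * (real (Suc m))\<^sup>2 - 1))) =
      (central_mass m)\<^sup>2 * (2 * real m + 1) * P *
      ((2 * real m + 1) * (2 * real m + 3) * (4 * (real m + 1)\<^sup>2) / ((2 * real m + 2)\<^sup>2 * (4 * (real m + 1)\<^sup>2 - 1)))"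
    by (simp add: central_mass_Suc power_mult_distrib power_divide power2_eq_square field_simps)
  also have "(4 * (real m + 1)\<^sup>2 - 1) = (2 * real m + 1) * (2 * real m + 3)"
    by (simp add: power2_eq_square algebra_simps)
  also have "(2 * real m + 1) * (2 * real m + 3) * (4 * (real m + 1)\<^sup>2) /
     ((2 * real m + 2)\<^sup>2 * ((2 * real m + 1) * (2 * real m + 3))) = 1"
  proof -
    have "(2 * real m + 2)\<^sup>2 = 4 * (real m + 1)\<^sup>2" by (simp add: power2_eq_square algebra_simps)
    then show ?thesis by simp
  qed
  finally have "(central_mass (Suc m))\<^sup>2 * (2 * real (Suc m) + 1) *
      (P * ((4 * (real (Suc m))\<^sup>2) / (4 * (real (Suc m))\<^sup>2 - 1))) = 1"
    using Suc by (simp only: P_def mult_1_right)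
  moreover have "(\<Prod>k=1..Suc m. (4 * (real k)\<^sup>2) / (4 * (real k)\<^sup>2 - 1)) =
      P * ((4 * (real (Suc m))\<^sup>2) / (4 * (real (Suc m))\<^sup>2 - 1))"
    by (simp add: P_def)
  ultimately show ?case by (simp only:)
qed

lemma central_mass_sq_limit: "(\<lambda>m. (central_mass m)\<^sup>2 * (2 * real m + 1)) \<longlonglongrightarrow> 2 / pi"
proof -
  have "(\<lambda>m. inverse (\<Prod>k=1..m. (4 * (real k)\<^sup>2) / (4 * (real k)\<^sup>2 - 1))) \<longlonglongrightarrow> inverse (pi / 2)"
    by (intro tendsto_inverse wallis) simp
  moreover have "inverse (\<Prod>k=1..m. (4 * (real k)\<^sup>2) / (4 * (real k)\<^sup>2 - 1)) =
      (central_mass m)\<^sup>2 * (2 * real m + 1)" for m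
    using central_mass_sq_wallis[of m] by (intro inverse_unique) (simp add: mult.commute)
  ultimately show ?thesis by simp
qed

text \<open>The sequence in \<open>central_mass_sq_limit\<close> decreases because
  \<open>(2m+1)(2m+3) <= (2m+2)^2\<close>, so every term lies above its limit
  \<open>2 / pi\<close>.\<close>

lemma central_mass_sq_ge: "(central_mass m)\<^sup>2 \<ge> 2 / (pi * (2 * real m + 1))"
proof -
  have "decseq (\<lambda>m. (central_mass m)\<^sup>2 * (2 * real m + 1))"
  proof (rule decseq_SucI)
    fix m
    have "(central_mass (Suc m))\<^sup>2 * (2 * real (Suc m) + 1) =
      (central_mass m)\<^sup>2 * (2 * real m + 1) * ((2 * real m + 1) * (2 * real m + 3) / (2 * real m + 2)\<^sup>2)"
      by (simp add: central_mass_Suc power_mult_distrib power_divide power2_eq_square field_simps)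
    also have "\<dots> \<le> (central_mass m)\<^sup>2 * (2 * real m + 1)"
      by (rule mult_left_le) (simp_all add: power2_eq_square algebra_simps add_pos_nonneg)
    finally show "(central_mass (Suc m))\<^sup>2 * (2 * real (Suc m) + 1) \<le> (central_mass m)\<^sup>2 * (2 * real m + 1)" .
  qed
  from decseq_ge[OF this central_mass_sq_limit, of m] show ?thesis
    by (simp add: divide_simps) (simp add: algebra_simps)
qed

text \<open>Scaled by \<open>m\<close> instead of \<open>2 * m + 1\<close>, the squares increase,
  since \<open>4m(m+1) <= (2m+1)^2\<close>; their limit is \<open>1 / pi\<close>. This is the upper
  counterpart of \<open>central_mass_sq_ge\<close>.\<close>

lemma central_mass_sq_le:
  assumes "m > 0"
  shows "(central_mass m)\<^sup>2 \<le> 1 / (pi * real m)"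
proof -
  have "incseq (\<lambda>m. (central_mass m)\<^sup>2 * real m)"
  proof (rule incseq_SucI)
    fix m
    have "(central_mass m)\<^sup>2 * (2 * real m + 1)\<^sup>2 / (4 * (real m + 1)) = (central_mass (Suc m))\<^sup>2 * real (Suc m)"
    proof -
      have "(2 * real m + 2)\<^sup>2 = 4 * (real m + 1) * (real m + 1)"
        by (simp add: power2_eq_square algebra_simps)
      then show ?thesis
        by (simp add: central_mass_Suc power_mult_distrib power_divide) (simp add: add.commute)
    qed
    moreover have "real m \<le> (2 * real m + 1)\<^sup>2 / (4 * (real m + 1))"
      by (simp add: power2_eq_square field_simps)
    then have "(central_mass m)\<^sup>2 * real m \<le> (central_mass m)\<^sup>2 * ((2 * real m + 1)\<^sup>2 / (4 * (real m + 1)))"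
      by (rule mult_left_mono) simp
    ultimately show "(central_mass m)\<^sup>2 * real m \<le> (central_mass (Suc m))\<^sup>2 * real (Suc m)"
      by simp
  qed
  moreover have "(\<lambda>m. (central_mass m)\<^sup>2 * real m) \<longlonglongrightarrow> 1 / pi"
  proof -
    have "(\<lambda>m. real m / (2 * real m + 1)) \<longlonglongrightarrow> 1 / 2" by real_asymp
    from tendsto_mult[OF central_mass_sq_limit this] show ?thesis
      by (simp add: add_nonneg_eq_0_iff)
  qed
  ultimately have "(central_mass m)\<^sup>2 * real m \<le> 1 / pi" by (rule incseq_le)
  then show ?thesis using assms by (simp add: field_simps)
qed

section \<open>A logarithm estimate for ratios of consecutive masses\<close>

text \<open>The derivative \<open>2u^2 / (1 - u^2)\<close> of \<open>f\<close> lies between 0 and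
  \<open>3u^2\<close> while \<open>u^2 <= 1/4\<close>, so \<open>f\<close> itself stays between 0
  and \<open>t ^ 3\<close>.\<close>

lemma ln_ratio_expansion:
  fixes t :: real
  assumes "0 \<le> t" "t \<le> 1 / 2"
  shows "\<bar>ln ((1 - t) / (1 + t)) + 2 * t\<bar> \<le> t ^ 3"
proof -
  define f where "f = (\<lambda>u::real. ln (1 + u) - ln (1 - u) - 2 * u)"
  have deriv: "(f has_real_derivative 2 * u\<^sup>2 / (1 - u\<^sup>2)) (at u)" if "0 \<le> u" "u \<le> t" for u
  proof -
    have u: "1 + u > 0" "1 - u > 0" using that assms by auto
    have "(f has_real_derivative (1 / (1 + u) + 1 / (1 - u) - 2)) (at u)"
      unfolding f_def using u by (auto intro!: derivative_eq_intros)
    moreover have "1 - u\<^sup>2 = (1 + u) * (1 - u)" by (simp add: power2_eq_square algebra_simps)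
    then have "1 / (1 + u) + 1 / (1 - u) - 2 = 2 * u\<^sup>2 / (1 - u\<^sup>2)"
      using u by (simp add: divide_simps)
    ultimately show ?thesis by simp
  qed
  have small: "u\<^sup>2 \<le> 1 / 4" if "0 \<le> u" "u \<le> t" for u
    using power_mono[of u "1/2" 2] that assms by (simp add: power2_eq_square)
  have "f 0 \<le> f t"
  proof (rule DERIV_nonneg_imp_nondecreasing[OF assms(1)])
    fix u assume "0 \<le> u" "u \<le> t"
    with deriv[of u] small[of u] show "\<exists>y. (f has_real_derivative y) (at u) \<and> 0 \<le> y"
      by (intro exI[of _ "2 * u\<^sup>2 / (1 - u\<^sup>2)"]) auto
  qed
  moreover have "(\<lambda>u. u ^ 3 - f u) 0 \<le> (\<lambda>u. u ^ 3 - f u) t"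
  proof (rule DERIV_nonneg_imp_nondecreasing[OF assms(1)])
    fix u assume u: "0 \<le> u" "u \<le> t"
    have "((\<lambda>u. u ^ 3 - f u) has_real_derivative 3 * u\<^sup>2 - 2 * u\<^sup>2 / (1 - u\<^sup>2)) (at u)"
      using deriv[OF u] by (auto intro!: derivative_eq_intros)
    moreover have "2 * u\<^sup>2 / (1 - u\<^sup>2) \<le> 3 * u\<^sup>2"
    proof -
      have "2 * u\<^sup>2 \<le> 3 * u\<^sup>2 * (1 - u\<^sup>2)"
        using mult_left_mono[of 2 "3 * (1 - u\<^sup>2)" "u\<^sup>2"] small[OF u] by (simp add: algebra_simps)
      then show ?thesis using small[OF u] by (simp add: divide_le_eq)
    qed
    ultimately show "\<exists>y. ((\<lambda>u. u ^ 3 - f u) has_real_derivative y) (at u) \<and> 0 \<le> y"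
      by (intro exI[of _ "3 * u\<^sup>2 - 2 * u\<^sup>2 / (1 - u\<^sup>2)"]) auto
  qed
  ultimately have "0 \<le> f t" "f t \<le> t ^ 3" by (simp_all add: f_def)
  moreover have "ln ((1 - t) / (1 + t)) + 2 * t = - f t"
    using assms by (simp add: f_def ln_div)
  ultimately show ?thesis by simp
qed

section \<open>The Gaussian comparison function\<close>

lemma narayana_sd_pos: "n \<ge> 2 \<Longrightarrow> narayana_sd n > 0"
  by (simp add: narayana_sd_def)

lemma narayana_sd_sq:
  "n \<ge> 2 \<Longrightarrow> (narayana_sd n)\<^sup>2 = (real n - 1) * (real n + 1) / (4 * (2 * real n - 1))"
  by (simp add: narayana_sd_def)

definition narayana_gauss :: "nat \<Rightarrow> real \<Rightarrow> real" where
  "narayana_gauss n x =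
     1 / narayana_sd n * std_normal_density ((x - narayana_mean n) / narayana_sd n)"

lemma narayana_gauss_eq:
  "narayana_gauss n x =
     exp (- (x - narayana_mean n)\<^sup>2 / (2 * (narayana_sd n)\<^sup>2)) / (narayana_sd n * sqrt (2 * pi))"
  by (simp add: narayana_gauss_def std_normal_density_def power_divide)

lemma narayana_gauss_pos: "n \<ge> 2 \<Longrightarrow> narayana_gauss n x > 0"
  using narayana_sd_pos[of n] by (simp add: narayana_gauss_eq)

lemma narayana_gauss_reflect: "narayana_gauss n (real n + 1 - x) = narayana_gauss n x"
proof -
  have "(real n + 1 - x - narayana_mean n)\<^sup>2 = (x - narayana_mean n)\<^sup>2"
    by (simp add: narayana_mean_def power2_eq_square field_simps)
  then show ?thesis by (simp add: narayana_gauss_eq)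
qed

lemma narayana_gauss_antimono:
  assumes "narayana_mean n \<le> x" "x \<le> y" "n \<ge> 2"
  shows "narayana_gauss n y \<le> narayana_gauss n x"
proof -
  have "(x - narayana_mean n)\<^sup>2 \<le> (y - narayana_mean n)\<^sup>2"
    using assms by (intro power_mono) auto
  then show ?thesis
    using narayana_sd_pos[OF assms(3)] by (simp add: narayana_gauss_eq divide_right_mono)
qed

text \<open>The square grows by \<open>2(x - \<mu>) + 1\<close>, which is \<open>2(x - n/2)\<close>
  because \<open>\<mu> = (n+1)/2\<close>. Hence steps are measured from \<open>n / 2\<close> and not
  from the mean.\<close>

lemma narayana_gauss_step:
  assumes "n \<ge> 2"
  shows "narayana_gauss n (x + 1) = narayana_gauss n x * exp (- (x - real n / 2) / (narayana_sd n)\<^sup>2)"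
proof -
  have "(x + 1 - narayana_mean n)\<^sup>2 = (x - narayana_mean n)\<^sup>2 + 2 * (x - real n / 2)"
    by (simp add: narayana_mean_def power2_eq_square field_simps)
  then have "- (x + 1 - narayana_mean n)\<^sup>2 / (2 * (narayana_sd n)\<^sup>2) =
      - (x - narayana_mean n)\<^sup>2 / (2 * (narayana_sd n)\<^sup>2) + - (x - real n / 2) / (narayana_sd n)\<^sup>2"
    using narayana_sd_pos[OF assms] by (simp add: divide_simps)
  then show ?thesis
    unfolding narayana_gauss_eq by (simp only: exp_add) simp
qed

section \<open>Recurrence, symmetry and monotonicity of the mass function\<close>

lemma binomial_Suc_real:
  "(real k + 1) * real (n choose Suc k) = (real n - real k) * real (n choose k)"
proof (cases "k \<le> n")
  case True
  have "Suc k * (n choose Suc k) = (n - k) * (n choose k)"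
    by (simp only: binomial_absorption binomial_absorb_comp)
  then have "real (Suc k * (n choose Suc k)) = real ((n - k) * (n choose k))"
    by (simp only:)
  then show ?thesis
    unfolding of_nat_mult using True by (simp add: of_nat_diff add.commute)
qed (simp add: binomial_eq_0)

text \<open>For \<open>k > n\<close> the factor \<open>n choose k\<close> is 0 and agrees with the
  default value of the mass, so the case distinction disappears.\<close>

lemma narayana_mass_eq:
  assumes "k \<ge> 1" "n \<ge> 1"
  shows "narayana_mass n (int k) =
    real (n choose (k - 1)) * real (n choose k) * (real n + 1) / (real n * real ((2 * n) choose n))"
  using assms by (auto simp: narayana_mass_def narayana_def catalan_def binomial_eq_0)

lemma narayana_mass_pos:
  assumes "1 \<le> k" "k \<le> n"
  shows "narayana_mass n (int k) > 0"
  using assms by (simp add: narayana_mass_eq)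

text \<open>The product of \<open>binomial_Suc_real\<close> at \<open>j\<close> and at
  \<open>Suc j\<close>, where \<open>k = Suc j\<close>. Without division it also covers
  \<open>k = n\<close>, where the next mass is 0.\<close>

lemma narayana_mass_step:
  assumes "k \<ge> 1" "n \<ge> 1"
  shows "real k * (real k + 1) * narayana_mass n (int k + 1) =
    (real n - real k + 1) * (real n - real k) * narayana_mass n (int k)"
proof -
  obtain j where k: "k = Suc j" using assms by (cases k) auto
  define D where "D = (real n + 1) / (real n * real ((2 * n) choose n))"
  have mass_Suc: "narayana_mass n (int k + 1) = real (n choose Suc j) * real (n choose Suc (Suc j)) * D"
    using narayana_mass_eq[of "Suc k" n] assms by (simp add: k D_def add.commute)
  have mass: "narayana_mass n (int k) = real (n choose j) * real (n choose Suc j) * D"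
    using narayana_mass_eq[of k n] assms by (simp add: k D_def)
  have "((real j + 1) * real (n choose Suc j)) * ((real (Suc j) + 1) * real (n choose Suc (Suc j))) =
      ((real n - real j) * real (n choose j)) * ((real n - real (Suc j)) * real (n choose Suc j))"
    by (simp only: binomial_Suc_real)
  from arg_cong[OF this, of "\<lambda>z. z * D"] show ?thesis
    unfolding mass_Suc mass by (simp add: k algebra_simps)
qed

text \<open>Symmetry of the binomials makes the reflection exchange the two factors
  \<open>n choose (k - 1)\<close> and \<open>n choose k\<close>.\<close>

lemma narayana_mass_reflect: "narayana_mass n (int n + 1 - k) = narayana_mass n k"
proof (cases "1 \<le> k \<and> k \<le> int n")
  case True
  then obtain j where j: "k = int j" "1 \<le> j" "j \<le> n"
    by (metis int_nat_eq nat_le_iff nat_mono nat_one_as_int order_trans zero_le_one)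
  have e: "int n + 1 - k = int (n + 1 - j)" using j by simp
  have "n choose (n - j) = n choose j" "n choose (n + 1 - j) = n choose (j - 1)"
    using j binomial_symmetric[of j n] binomial_symmetric[of "j - 1" n] by simp_all
  moreover have "n + 1 - j - 1 = n - j" by simp
  moreover have "narayana_mass n (int (n + 1 - j)) = real (n choose (n + 1 - j - 1)) *
      real (n choose (n + 1 - j)) * (real n + 1) / (real n * real ((2 * n) choose n))"
    using j by (intro narayana_mass_eq) auto
  ultimately show ?thesis
    unfolding e unfolding j(1) using j narayana_mass_eq[of j n] by (simp only: mult.commute)
qed (auto simp: narayana_mass_def)

text \<open>In \<open>narayana_mass_step\<close>, \<open>(n-k+1)(n-k) <= (k+1)k\<close> as soon as
  \<open>n - k <= k\<close>; past \<open>n\<close> the mass is 0.\<close>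

lemma narayana_mass_antimono:
  assumes "n \<ge> 1" "real n \<le> 2 * real k" "k \<le> l"
  shows "narayana_mass n (int l) \<le> narayana_mass n (int k)"
  using assms(3)
proof (induction l rule: dec_induct)
  case (step l)
  have l: "l \<ge> 1" "real n \<le> 2 * real l" using assms step by auto
  have "real l * (real l + 1) * narayana_mass n (int l + 1) \<le> real l * (real l + 1) * narayana_mass n (int l)"
  proof (cases "l \<le> n")
    case True
    have "(real n - real l + 1) * (real n - real l) \<le> (real l + 1) * real l"
      using l True by (intro mult_mono) auto
    then show ?thesis
      unfolding narayana_mass_step[OF l(1) assms(1)]
      by (intro mult_right_mono) (simp_all add: narayana_mass_nonneg mult.commute)
  qed (auto simp: narayana_mass_def)
  then have "narayana_mass n (int l + 1) \<le> narayana_mass n (int l)"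
    using l(1) by (simp add: mult_le_cancel_left)
  then show ?case using step by (simp add: add.commute)
qed simp

section \<open>Drift of the mass against the Gaussian in one step\<close>

text \<open>Three replacements lead from the log ratio to \<open>- x / \<sigma>^2\<close>: the
  logarithm by \<open>- 2t\<close> (\<open>r1\<close>), \<open>a + x^2\<close> by \<open>a\<close>
  in the denominator of \<open>t\<close> (\<open>r2\<close>), and \<open>2(N+1)/a\<close> by
  \<open>1/\<sigma>^2\<close> (\<open>r3\<close>). The cubic errors 64 and 32 add up to 96; the
  linear one comes from \<open>r3\<close>.\<close>

lemma narayana_ratio_bound:
  assumes n: "n \<ge> 2" and x: "x = real k - real n / 2" "0 \<le> x" "x \<le> real n / 8"
  shows "\<bar>ln (narayana_mass n (int k + 1) / narayana_mass n (int k)) + x / (narayana_sd n)\<^sup>2\<bar>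
    \<le> 8 * x / (real n)\<^sup>2 + 96 * x ^ 3 / (real n) ^ 3"
proof -
  define N where "N = real n"
  have N: "N \<ge> 2" using n by (simp add: N_def)
  have kx: "real k = x + N / 2" using x by (simp add: N_def)
  have "real k > 0" "real k \<le> real n" using x N unfolding kx by (auto simp: N_def)
  then have k: "1 \<le> k" "k \<le> n" by auto
  \<comment> \<open>With \<open>k = x + N/2\<close> the two products in
    \<open>narayana_mass_step\<close> are \<open>a + x^2 + (N+1)x\<close> and
    \<open>a + x^2 - (N+1)x\<close>; dividing by \<open>a + x^2\<close> leaves \<open>1 + t\<close>
    and \<open>1 - t\<close>.\<close>
  define a where "a = N * (N + 2) / 4"
  define t where "t = (N + 1) * x / (a + x\<^sup>2)"
  have a: "a > 0" using N by (simp add: a_def)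
  have ax: "a + x\<^sup>2 > 0" using a by (simp add: add_pos_nonneg)
  have t0: "t \<ge> 0" using N x(2) ax by (simp add: t_def)
  have tle: "t \<le> 4 * x / N"
  proof -
    have "(N + 1) * x / (a + x\<^sup>2) \<le> (N + 1) * x / a"
      using N x(2) a by (intro divide_left_mono mult_pos_pos) (use ax in auto)
    also have "\<dots> \<le> 4 * x / N"
      using N x(2) mult_nonneg_nonneg[of x N] by (simp add: a_def divide_simps) (simp add: algebra_simps)
    finally show ?thesis by (simp add: t_def)
  qed
  \<comment> \<open>The range \<open>x <= n / 8\<close> is what brings \<open>t\<close> into the
    scope of \<open>ln_ratio_expansion\<close>.\<close>
  also have "\<dots> \<le> 1 / 2" using x N by (simp add: N_def field_simps)
  finally have t_half: "t \<le> 1 / 2" .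
  have "t ^ 3 \<le> (4 * x / N) ^ 3" using tle t0 by (rule power_mono)
  then have t3: "t ^ 3 \<le> 64 * x ^ 3 / N ^ 3" by (simp add: power_divide power_mult_distrib)
  have ratio: "narayana_mass n (int k + 1) / narayana_mass n (int k) = (1 - t) / (1 + t)"
  proof -
    have "narayana_mass n (int k) > 0" using k by (rule narayana_mass_pos)
    moreover have "real k * (real k + 1) = (a + x\<^sup>2) * (1 + t)"
      using ax by (simp add: t_def field_simps) (simp add: kx a_def power2_eq_square power4_eq_xxxx field_simps)
    moreover have "(real n - real k + 1) * (real n - real k) = (a + x\<^sup>2) * (1 - t)"
      using ax by (simp add: t_def field_simps) (simp add: kx a_def power2_eq_square power4_eq_xxxx field_simps flip: N_def)
    ultimately have "(a + x\<^sup>2) * (1 + t) * narayana_mass n (int k + 1) = (a + x\<^sup>2) * (1 - t) * narayana_mass n (int k)"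
      using narayana_mass_step[of k n] k n by simp
    then have "(1 + t) * narayana_mass n (int k + 1) = (1 - t) * narayana_mass n (int k)"
      using ax by simp
    then show ?thesis
      using t0 \<open>narayana_mass n (int k) > 0\<close> by (simp add: field_simps)
  qed
  have r1: "\<bar>ln ((1 - t) / (1 + t)) + 2 * t\<bar> \<le> 64 * x ^ 3 / N ^ 3"
    using ln_ratio_expansion[OF t0 t_half] t3 by linarith
  have r2: "\<bar>2 * (N + 1) * x / a - 2 * t\<bar> \<le> 32 * x ^ 3 / N ^ 3"
  proof -
    have e: "2 * (N + 1) * x / a - 2 * t = 2 * (N + 1) * x ^ 3 / (a * (a + x\<^sup>2))"
      using a ax by (simp add: t_def divide_simps) (simp add: algebra_simps power2_eq_square power3_eq_cube power4_eq_xxxx)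
    have "2 * (N + 1) * x ^ 3 / (a * (a + x\<^sup>2)) \<le> 2 * (N + 1) * x ^ 3 / (a * a)"
      using N x(2) a ax by (intro divide_left_mono mult_left_mono mult_pos_pos) auto
    also have "\<dots> = x ^ 3 * (2 * (N + 1) / (a * a))" by simp
    also have "\<dots> \<le> x ^ 3 * (32 / N ^ 3)"
    proof (intro mult_left_mono)
      have "2 * (N + 1) / (a * a) = 32 * (N + 1) / (N\<^sup>2 * (N + 2)\<^sup>2)"
        by (simp add: a_def power2_eq_square)
      also have "\<dots> \<le> 32 / N ^ 3"
        using N by (simp add: divide_simps) (simp add: algebra_simps power2_eq_square power3_eq_cube power4_eq_xxxx)
      finally show "2 * (N + 1) / (a * a) \<le> 32 / N ^ 3" .
    qed (use x(2) in simp)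
    finally show ?thesis
      using e N x(2) a ax by (simp add: mult.commute)
  qed
  \<comment> \<open>Both terms are \<open>8x/N\<close> to leading order, as \<sigma> squared is
    about \<open>N/8\<close>; after this cancellation the difference has order
    \<open>x/N^2\<close>.\<close>
  have r3: "\<bar>x / (narayana_sd n)\<^sup>2 - 2 * (N + 1) * x / a\<bar> \<le> 8 * x / N\<^sup>2"
  proof -
    have e: "x / (narayana_sd n)\<^sup>2 - 2 * (N + 1) * x / a = x * (4 * (N\<^sup>2 + 2) / (N * (N + 2) * (N - 1) * (N + 1)))"
      unfolding narayana_sd_sq[OF n] N_def[symmetric] a_def
      using N by (simp add: divide_simps) (simp add: algebra_simps power2_eq_square)
    have "4 * (N\<^sup>2 + 2) / (N * (N + 2) * (N - 1) * (N + 1)) \<le> 8 / N\<^sup>2"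
    proof -
      have "(N\<^sup>2 + 2) * N \<le> 2 * ((N + 2) * (N - 1) * (N + 1))"
      proof -
        \<comment> \<open>The two sides differ by \<open>N^3 + 4N^2 - 4N - 4\<close>, which exceeds
          this sum of nonnegative terms by 4.\<close>
        have "0 \<le> (N - 2) * (N\<^sup>2 + 2 * N + 4) + 4 * (N - 2) * N + 4 * N"
          using N by (intro add_nonneg_nonneg mult_nonneg_nonneg) auto
        then show ?thesis by (simp add: algebra_simps power2_eq_square)
      qed
      then have "4 * (N\<^sup>2 + 2) / (N * ((N + 2) * (N - 1) * (N + 1))) \<le> 8 / (N * N)"
        using N by (simp add: divide_simps) (simp add: algebra_simps)
      then show ?thesis by (simp add: power2_eq_square mult.assoc)
    qed
    then have "x * (4 * (N\<^sup>2 + 2) / (N * (N + 2) * (N - 1) * (N + 1))) \<le> x * (8 / N\<^sup>2)"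
      using x(2) by (intro mult_left_mono)
    moreover have "x * (4 * (N\<^sup>2 + 2) / (N * (N + 2) * (N - 1) * (N + 1))) \<ge> 0"
      using x(2) N by simp
    moreover have "x * (8 / N\<^sup>2) = 8 * x / N\<^sup>2" by simp
    ultimately show ?thesis unfolding e by linarith
  qed
  show ?thesis
    unfolding ratio N_def[symmetric] using r1 r2 r3 by (simp add: abs_le_iff)
qed

section \<open>The mass at the centre\<close>

text \<open>The index is the mean rounded up. \<open>central_mass n\<close> comes from
  \<open>(2 * n) choose n\<close> in the denominator; \<open>F\<close> is essentially the square of
  a central mass of half the size, with bounds in a form common to both parities.\<close>

lemma narayana_mass_mid:
  assumes n: "n \<ge> 1"
  obtains F where "narayana_mass n (int (n div 2 + 1)) = F / central_mass n"
    "2 / (pi * (real n + 2)) \<le> F" "F \<le> 2 / (pi * real n)"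
proof (cases "even n")
  case True
  then obtain m where m: "n = 2 * m" by (elim evenE)
  then have m0: "m > 0" using n by simp
  define F where "F = (central_mass m)\<^sup>2 * ((real n + 1) / (real n + 2))"
  have c: "real (n choose Suc m) = real m / (real m + 1) * real (n choose m)"
    using binomial_Suc_real[of m n] by (simp add: m field_simps)
  have "narayana_mass n (int (n div 2 + 1)) = real (n choose m) * real (n choose Suc m) * (real n + 1) / (real n * real ((2 * n) choose n))"
    using narayana_mass_eq[of "Suc m" n] n by (simp add: m)
  also have "\<dots> = (real (n choose m))\<^sup>2 * (real n + 1) / ((real n + 2) * real ((2 * n) choose n))"
    unfolding c using m0 by (simp add: m power2_eq_square divide_simps)
  also have "\<dots> = F / central_mass n"
  proof -
    have "(4::real) ^ (2 * m) = 4 ^ m * 4 ^ m" by (simp add: mult_2 power_add)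
    then show ?thesis
      unfolding F_def central_mass_def m by (simp add: power_divide power2_eq_square)
  qed
  finally have "narayana_mass n (int (n div 2 + 1)) = F / central_mass n" .
  moreover have "2 / (pi * (real n + 2)) \<le> F"
  proof -
    have "2 / (pi * (real n + 1)) * ((real n + 1) / (real n + 2)) \<le> F"
      unfolding F_def using central_mass_sq_ge[of m] by (intro mult_right_mono) (auto simp: m)
    moreover have "2 / (pi * (real n + 1)) * ((real n + 1) / (real n + 2)) = 2 / (pi * (real n + 2))"
      by (simp add: divide_simps)
    ultimately show ?thesis by (simp only:)
  qed
  moreover have "F \<le> 2 / (pi * real n)"
  proof -
    have "F \<le> (central_mass m)\<^sup>2"
      unfolding F_def by (intro mult_left_le) auto
    also have "\<dots> \<le> 2 / (pi * real n)"
      using central_mass_sq_le[OF m0] by (simp add: m)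
    finally show ?thesis .
  qed
  ultimately show ?thesis by (rule that)
next
  case False
  then obtain j where j: "n = 2 * j + 1" by (elim oddE)
  define F where "F = (central_mass (Suc j))\<^sup>2 * ((real n + 1) / real n)"
  \<comment> \<open>For odd \<open>n\<close> the two middle coefficients agree, so by Pascal's rule
    each is half of the central coefficient of row \<open>2 * Suc j\<close>.\<close>
  have "(2 * Suc j) choose Suc j = (n choose j) + (n choose Suc j)"
    by (simp add: j)
  moreover have "n choose Suc j = n choose j"
    using binomial_symmetric[of j n] by (simp add: j)
  ultimately have c: "real (n choose j) = real ((2 * Suc j) choose Suc j) / 2"
      "real (n choose Suc j) = real ((2 * Suc j) choose Suc j) / 2"
    by simp_all
  have "narayana_mass n (int (n div 2 + 1)) = real (n choose j) * real (n choose Suc j) * (real n + 1) / (real n * real ((2 * n) choose n))"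
    using narayana_mass_eq[of "Suc j" n] n by (simp add: j)
  also have "\<dots> = F / central_mass n"
  proof -
    have "(4::real) ^ n * 4 = 4 ^ Suc j * 4 ^ Suc j" by (simp add: j flip: power_add mult_2)
    then show ?thesis
      unfolding c F_def central_mass_def using n
      by (simp add: power_divide power2_eq_square divide_simps del: power_Suc binomial_Suc_Suc)
  qed
  finally have "narayana_mass n (int (n div 2 + 1)) = F / central_mass n" .
  moreover have "2 / (pi * (real n + 2)) \<le> F"
  proof -
    have "2 / (pi * (real n + 2)) \<le> (central_mass (Suc j))\<^sup>2"
      using central_mass_sq_ge[of "Suc j"] by (simp add: j algebra_simps)
    also have "\<dots> \<le> F"
      using mult_left_mono[of 1 "(real n + 1) / real n" "(central_mass (Suc j))\<^sup>2"] n
      by (simp add: F_def)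
    finally show ?thesis .
  qed
  moreover have "F \<le> 2 / (pi * real n)"
  proof -
    have "1 / (pi * real (Suc j)) = 2 / (pi * (real n + 1))"
      by (simp add: j divide_simps)
    then have "F \<le> 2 / (pi * (real n + 1)) * ((real n + 1) / real n)"
      unfolding F_def using central_mass_sq_le[of "Suc j"] by (intro mult_right_mono) simp_all
    moreover have "2 / (pi * (real n + 1)) * ((real n + 1) / real n) = 2 / (pi * real n)"
      by (simp add: divide_simps)
    ultimately show ?thesis by (simp only:)
  qed
  ultimately show ?thesis by (rule that)
qed

text \<open>\<open>central_mass n\<close> lies between \<open>1 / sqrt (pi (n + 1/2))\<close> and
  \<open>1 / sqrt (pi n)\<close>. As it is a denominator, its upper bound gives the lower estimate
  and conversely.\<close>

lemma narayana_mass_mid_bounds: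
  assumes n: "n \<ge> 1"
  shows "2 * sqrt (real n) / (sqrt pi * (real n + 2)) \<le> narayana_mass n (int (n div 2 + 1))"
    and "narayana_mass n (int (n div 2 + 1)) \<le> 2 * sqrt (real n + 1 / 2) / (sqrt pi * real n)"
proof -
  obtain F where F: "narayana_mass n (int (n div 2 + 1)) = F / central_mass n"
    "2 / (pi * (real n + 2)) \<le> F" "F \<le> 2 / (pi * real n)"
    using narayana_mass_mid[OF n] .
  have pi: "pi = sqrt pi * sqrt pi" by simp
  have F0: "F \<ge> 0" using F(2) by (rule order_trans[rotated]) simp
  have c_le: "central_mass n \<le> 1 / (sqrt pi * sqrt (real n))"
    using real_sqrt_le_mono[OF central_mass_sq_le[of n]] n central_mass_pos[of n]
    by (simp add: real_sqrt_divide real_sqrt_mult)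
  have "sqrt (2 / (pi * (2 * real n + 1))) \<le> central_mass n"
    using real_sqrt_le_mono[OF central_mass_sq_ge[of n]] central_mass_pos[of n] by simp
  moreover have "2 / (pi * (2 * real n + 1)) = 1 / (pi * (real n + 1 / 2))"
    by (simp add: divide_simps)
  ultimately have c_ge: "1 / (sqrt pi * sqrt (real n + 1 / 2)) \<le> central_mass n"
    by (simp add: real_sqrt_divide real_sqrt_mult)
  have "2 / (pi * (real n + 2)) / (1 / (sqrt pi * sqrt (real n))) \<le> F / central_mass n"
    using F F0 c_le central_mass_pos[of n] by (intro frac_le) auto
  also have "2 / (pi * (real n + 2)) / (1 / (sqrt pi * sqrt (real n))) = 2 * sqrt (real n) / (sqrt pi * (real n + 2))"
    by (subst pi) (simp add: divide_simps)
  finally show "2 * sqrt (real n) / (sqrt pi * (real n + 2)) \<le> narayana_mass n (int (n div 2 + 1))"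
    by (simp only: F)
  have "F / central_mass n \<le> 2 / (pi * real n) / (1 / (sqrt pi * sqrt (real n + 1 / 2)))"
    using F F0 c_ge n by (intro frac_le) auto
  also have "\<dots> = 2 * sqrt (real n + 1 / 2) / (sqrt pi * real n)"
    by (subst pi) (simp add: divide_simps)
  finally show "narayana_mass n (int (n div 2 + 1)) \<le> 2 * sqrt (real n + 1 / 2) / (sqrt pi * real n)"
    by (simp only: F)
qed

text \<open>The logarithms are those of the two bounds in \<open>narayana_mass_mid_bounds\<close>
  times \<open>\<sigma> sqrt (2 pi)\<close>. The last term is the Gaussian exponent at distance 1/2
  from the mean.\<close>

definition mid_error :: "nat \<Rightarrow> real" where
  "mid_error n = \<bar>ln (narayana_sd n * sqrt (8 * real n + 4) / real n)\<bar>
     + \<bar>ln (narayana_sd n * sqrt (8 * real n) / (real n + 2))\<bar> + 1 / (8 * (narayana_sd n)\<^sup>2)"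

lemma ln_mass_gauss_mid:
  assumes n: "n \<ge> 2"
  defines "k \<equiv> n div 2 + 1"
  shows "\<bar>ln (narayana_mass n (int k) / narayana_gauss n (real k))\<bar> \<le> mid_error n"
proof -
  define s where "s = narayana_sd n"
  have s: "s > 0" using narayana_sd_pos[OF n] by (simp add: s_def)
  define y where "y = real k - narayana_mean n"
  \<comment> \<open>By parity, \<open>y\<close> is 1/2 for even \<open>n\<close> and 0 for odd
    \<open>n\<close>.\<close>
  have "real n = 2 * real (n div 2) \<or> real n = 2 * real (n div 2) + 1"
    by (metis add.commute even_two_times_div_two odd_two_times_div_two_succ of_nat_1 of_nat_add of_nat_mult of_nat_numeral)
  then have "\<bar>y\<bar> \<le> 1 / 2" by (auto simp: y_def k_def narayana_mean_def field_simps)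
  then have y2: "y\<^sup>2 \<le> 1 / 4"
    using power_mono[of "\<bar>y\<bar>" "1/2" 2] by (simp add: power2_eq_square)
  define M where "M = narayana_mass n (int k)"
  define e where "e = exp (y\<^sup>2 / (2 * s\<^sup>2))"
  have e: "e \<ge> 1" "ln e = y\<^sup>2 / (2 * s\<^sup>2)" by (simp_all add: e_def)
  have ln_e: "0 \<le> ln e" "ln e \<le> 1 / (8 * s\<^sup>2)"
    using s y2 unfolding e by (simp_all add: divide_simps)
  have q: "M / narayana_gauss n (real k) = M * (s * sqrt pi * sqrt 2) * e"
    unfolding narayana_gauss_eq e_def s_def[symmetric] y_def[symmetric]
    by (simp add: real_sqrt_mult exp_minus field_simps)
  have k: "1 \<le> k" "k \<le> n" using n by (auto simp: k_def)
  have M0: "M > 0" using narayana_mass_pos[OF k] by (simp add: M_def)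
  have lo: "s * sqrt (8 * real n) / (real n + 2) \<le> M * (s * sqrt pi * sqrt 2)"
  proof -
    have "2 * sqrt (real n) / (sqrt pi * (real n + 2)) * (s * sqrt pi * sqrt 2) \<le> M * (s * sqrt pi * sqrt 2)"
      using narayana_mass_mid_bounds(1)[of n] n s by (intro mult_right_mono) (auto simp: M_def k_def)
    moreover have "sqrt (8 * real n) = 2 * sqrt 2 * sqrt (real n)"
      using real_sqrt_mult[of 4 "2 * real n"] by (simp add: real_sqrt_mult)
    ultimately show ?thesis by (simp add: mult_ac)
  qed
  have hi: "M * (s * sqrt pi * sqrt 2) \<le> s * sqrt (8 * real n + 4) / real n"
  proof -
    have "M * (s * sqrt pi * sqrt 2) \<le> 2 * sqrt (real n + 1 / 2) / (sqrt pi * real n) * (s * sqrt pi * sqrt 2)"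
      using narayana_mass_mid_bounds(2)[of n] n s by (intro mult_right_mono) (auto simp: M_def k_def)
    moreover have "sqrt (8 * real n + 4) = 2 * sqrt 2 * sqrt (real n + 1 / 2)"
      using real_sqrt_mult[of 4 "2 * (real n + 1 / 2)"] real_sqrt_mult[of 2 "real n + 1 / 2"] by (simp add: algebra_simps)
    ultimately show ?thesis by (simp add: mult_ac)
  qed
  have M': "M * (s * sqrt pi * sqrt 2) > 0" using M0 s by simp
  have "ln (s * sqrt (8 * real n) / (real n + 2)) \<le> ln (M * (s * sqrt pi * sqrt 2))"
    using lo s n M' by (subst ln_le_cancel_iff) auto
  moreover have "ln (M * (s * sqrt pi * sqrt 2)) \<le> ln (s * sqrt (8 * real n + 4) / real n)"
    using hi M' by (simp only: ln_mono)
  moreover have "ln (M / narayana_gauss n (real k)) = ln (M * (s * sqrt pi * sqrt 2)) + ln e"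
    unfolding q using M' e(1) by (intro ln_mult_pos) auto
  ultimately show ?thesis
    using ln_e unfolding mid_error_def s_def[symmetric] M_def[symmetric] by linarith
qed

section \<open>Telescoping away from the centre\<close>

text \<open>Each step changes the logarithm by the quantity in \<open>narayana_ratio_bound\<close>;
  bounding every offset \<open>x\<close> by \<open>L\<close> makes the cost per step
  uniform.\<close>

lemma ln_mass_gauss:
  assumes "n \<ge> 2" "i \<le> L" "1 \<le> L" "real L \<le> real n / 8"
  defines "mid \<equiv> n div 2 + 1"
  shows "\<bar>ln (narayana_mass n (int (mid + i)) / narayana_gauss n (real (mid + i)))\<bar>
    \<le> mid_error n + real i * (8 * real L / (real n)\<^sup>2 + 96 * real L ^ 3 / (real n) ^ 3)"
  using assms(2)
proof (induction i)
  case 0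
  then show ?case using ln_mass_gauss_mid[OF assms(1)] by (simp add: mid_def)
next
  case (Suc i)
  define k where "k = mid + i"
  define x where "x = real k - real n / 2"
  define D where "D = 8 * real L / (real n)\<^sup>2 + 96 * real L ^ 3 / (real n) ^ 3"
  have mid: "real n / 2 \<le> real mid" "real mid \<le> real n / 2 + 1"
    unfolding mid_def by linarith+
  \<comment> \<open>The centre is at most \<open>n/2 + 1\<close>, so \<open>x <= i + 1\<close>, and
    \<open>Suc i <= L\<close> absorbs the extra 1.\<close>
  have x: "0 \<le> x" "x \<le> real L" using mid Suc.prems by (auto simp: x_def k_def)
  \<comment> \<open>Keeps both masses inside the support, hence positive, so that the logarithms
    split.\<close>
  have "real k + 1 \<le> real n" using x assms(3,4) by (auto simp: x_def)
  then have k: "1 \<le> k" "Suc k \<le> n" by (auto simp: k_def mid_def)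
  define r where "r = narayana_mass n (int k + 1) / narayana_mass n (int k)"
  have m0: "narayana_mass n (int k) > 0" using narayana_mass_pos[of k n] k by simp
  have "narayana_mass n (int k + 1) > 0" using narayana_mass_pos[of "Suc k" n] k by (simp add: add.commute)
  then have r0: "r > 0" using m0 by (simp add: r_def)
  have g0: "narayana_gauss n (real k) > 0" using narayana_gauss_pos[OF assms(1)] .
  have q0: "narayana_mass n (int k) / narayana_gauss n (real k) > 0" using m0 g0 by simp
  have g1: "narayana_gauss n (real k + 1) = narayana_gauss n (real k) * exp (- x / (narayana_sd n)\<^sup>2)"
    using narayana_gauss_step[OF assms(1), of "real k"] by (simp add: x_def)
  have q1: "narayana_mass n (int k + 1) / narayana_gauss n (real k + 1) =
     narayana_mass n (int k) / narayana_gauss n (real k) * (r * exp (x / (narayana_sd n)\<^sup>2))"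
    unfolding g1 using m0 by (simp add: r_def exp_minus divide_simps)
  have "ln (r * exp (x / (narayana_sd n)\<^sup>2)) = ln r + x / (narayana_sd n)\<^sup>2"
    using r0 by (simp add: ln_mult_pos)
  then have "ln (narayana_mass n (int k + 1) / narayana_gauss n (real k + 1)) =
     ln (narayana_mass n (int k) / narayana_gauss n (real k)) + (ln r + x / (narayana_sd n)\<^sup>2)"
    unfolding q1 using q0 r0 by (subst ln_mult_pos) simp_all
  moreover have "\<bar>ln r + x / (narayana_sd n)\<^sup>2\<bar> \<le> D"
  proof -
    have "\<bar>ln r + x / (narayana_sd n)\<^sup>2\<bar> \<le> 8 * x / (real n)\<^sup>2 + 96 * x ^ 3 / (real n) ^ 3"
      unfolding r_def using x assms(4) by (intro narayana_ratio_bound[OF assms(1)]) (auto simp: x_def)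
    also have "\<dots> \<le> D"
      unfolding D_def using x by (intro add_mono divide_right_mono mult_left_mono power_mono) auto
    finally show ?thesis .
  qed
  moreover have "\<bar>ln (narayana_mass n (int k) / narayana_gauss n (real k))\<bar> \<le> mid_error n + real i * D"
    using Suc by (simp add: k_def D_def)
  moreover have "int (mid + Suc i) = int k + 1" "real (mid + Suc i) = real k + 1"
    by (simp_all add: k_def)
  moreover have "real (Suc i) * D = real i * D + D" by (simp add: algebra_simps)
  ultimately show ?case unfolding D_def[symmetric] by (simp only:)
qed

section \<open>From log ratios to an absolute error at every integer\<close>

lemma abs_exp_minus_one_le: "\<bar>exp u - 1\<bar> \<le> \<bar>u\<bar> * exp \<bar>u\<bar>" for u :: real
proof (cases "u \<ge> 0")
  case True
  have "1 - u \<le> exp (- u)" using exp_ge_add_one_self[of "- u"] by simp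
  then have "(1 - u) * exp u \<le> exp (- u) * exp u" by (rule mult_right_mono) simp
  then show ?thesis using True by (simp add: exp_minus algebra_simps)
next
  case False
  have "1 - exp u \<le> - u" using exp_ge_add_one_self[of u] by linarith
  also have "\<dots> \<le> - u * exp (- u)" using mult_left_mono[of 1 "exp (- u)" "- u"] False by simp
  finally show ?thesis using False by simp
qed

lemma exp_minus_le_inverse: "exp (- v) \<le> 1 / v" if "v > 0" for v :: real
  proof -
  have "v \<le> exp v" using exp_ge_add_one_self[of v] by linarith
  then show ?thesis using that by (simp add: exp_minus field_simps)
qed

text \<open>Within \<open>L\<close> of the centre the error is \<open>g * |exp u - 1|\<close> with
  \<open>|u| <= E\<close> and \<open>g <= 1/\<sigma>\<close>, which gives the term \<open>E\<close>.
  Farther out, mass and Gaussian are each at most \<open>g K * exp E\<close> at the last near point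
  \<open>K\<close>, which gives \<open>2\<sigma>^2/L^2\<close>. Reflection covers the left
  half.\<close>

lemma narayana_local_error:
  assumes n: "n \<ge> 2" and L: "1 \<le> L" "real L \<le> real n / 8"
  defines "E \<equiv> mid_error n + real L * (8 * real L / (real n)\<^sup>2 + 96 * real L ^ 3 / (real n) ^ 3)"
  shows "\<bar>narayana_mass n j - narayana_gauss n (real_of_int j)\<bar>
    \<le> exp E / narayana_sd n * (E + 2 * (narayana_sd n)\<^sup>2 / (real L)\<^sup>2)"
proof -
  define s where "s = narayana_sd n"
  define B where "B = exp E / s * (E + 2 * s\<^sup>2 / (real L)\<^sup>2)"
  define mid where "mid = n div 2 + 1"
  define D where "D = 8 * real L / (real n)\<^sup>2 + 96 * real L ^ 3 / (real n) ^ 3"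
  have s: "s > 0" using narayana_sd_pos[OF n] by (simp add: s_def)
  have D0: "D \<ge> 0" by (simp add: D_def)
  have "mid_error n \<ge> 0" by (simp add: mid_error_def)
  then have E0: "E \<ge> 0" using D0 by (simp add: E_def D_def[symmetric])
  have g_max: "narayana_gauss n x \<le> 1 / s * exp (- (x - narayana_mean n)\<^sup>2 / (2 * s\<^sup>2))" for x
  proof -
    have "1 \<le> sqrt (2 * pi)" using pi_gt3 by (intro real_le_rsqrt) auto
    then have "1 / (s * sqrt (2 * pi)) \<le> 1 / s" using s by (simp add: divide_simps)
    from mult_right_mono[OF this, of "exp (- (x - narayana_mean n)\<^sup>2 / (2 * s\<^sup>2))"]
    show ?thesis by (simp add: narayana_gauss_eq s_def)
  qed
  have g0: "narayana_gauss n x > 0" for x by (rule narayana_gauss_pos[OF n])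
  have near: "\<exists>u. \<bar>u\<bar> \<le> E \<and> narayana_mass n (int (mid + i)) = narayana_gauss n (real (mid + i)) * exp u" if "i \<le> L" for i
  proof (intro exI conjI)
    let ?q = "narayana_mass n (int (mid + i)) / narayana_gauss n (real (mid + i))"
    have "real i * D \<le> real L * D" using that D0 by (intro mult_right_mono) auto
    then show "\<bar>ln ?q\<bar> \<le> E"
      using ln_mass_gauss[OF n that L] unfolding mid_def E_def D_def by linarith
    have "real (mid + i) \<le> real n" using that L unfolding mid_def by linarith
    then have "narayana_mass n (int (mid + i)) > 0"
      by (intro narayana_mass_pos) (auto simp: mid_def)
    then have "?q > 0" using g0 by simp
    then show "narayana_mass n (int (mid + i)) = narayana_gauss n (real (mid + i)) * exp (ln ?q)"
      using g0[of "real (mid + i)"] by simp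
  qed
  have upper: "\<bar>narayana_mass n (int k) - narayana_gauss n (real k)\<bar> \<le> B" if "mid \<le> k" for k
  proof (cases "k \<le> mid + L")
    case True
    define i where "i = k - mid"
    have i: "k = mid + i" "i \<le> L" using that True by (auto simp: i_def)
    obtain u where u: "\<bar>u\<bar> \<le> E" "narayana_mass n (int k) = narayana_gauss n (real k) * exp u"
      using near[OF i(2)] unfolding i(1)[symmetric] by blast
    have "narayana_gauss n (real k) * exp u - narayana_gauss n (real k) = narayana_gauss n (real k) * (exp u - 1)"
      by (simp add: right_diff_distrib)
    then have "\<bar>narayana_mass n (int k) - narayana_gauss n (real k)\<bar> = narayana_gauss n (real k) * \<bar>exp u - 1\<bar>"
      using g0[of "real k"] unfolding u(2) by (simp add: abs_mult)
    also have "\<dots> \<le> 1 / s * (E * exp E)"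
    proof (rule mult_mono)
      have "narayana_gauss n (real k) \<le> 1 / s * exp (- (real k - narayana_mean n)\<^sup>2 / (2 * s\<^sup>2))"
        by (rule g_max)
      also have "\<dots> \<le> 1 / s" using s by (intro mult_left_le) auto
      finally show "narayana_gauss n (real k) \<le> 1 / s" .
      have "\<bar>exp u - 1\<bar> \<le> \<bar>u\<bar> * exp \<bar>u\<bar>" by (rule abs_exp_minus_one_le)
      also have "\<dots> \<le> E * exp E" using u(1) E0 by (intro mult_mono) auto
      finally show "\<bar>exp u - 1\<bar> \<le> E * exp E" .
    qed (use s in auto)
    also have "\<dots> = exp E / s * E" by simp
    also have "\<dots> \<le> B" unfolding B_def using s by (intro mult_left_mono) auto
    finally show ?thesis .
  next
    case False
    \<comment> \<open>The near estimate at \<open>K\<close> bounds the mass by the Gaussian there,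
      so monotonicity alone controls the tail of the mass.\<close>
    define K where "K = mid + L"
    have "real n \<le> 2 * real (n div 2) + 1" by linarith
    then have K: "narayana_mean n + real L \<le> real K" "K \<le> k"
      using False by (auto simp: K_def mid_def narayana_mean_def)
    obtain u where u: "\<bar>u\<bar> \<le> E" "narayana_mass n (int K) = narayana_gauss n (real K) * exp u"
      using near[of L] unfolding K_def by blast
    have gK: "narayana_gauss n (real K) \<le> 1 / s * (2 * s\<^sup>2 / (real L)\<^sup>2)"
    proof -
      have "exp (- (real K - narayana_mean n)\<^sup>2 / (2 * s\<^sup>2)) \<le> exp (- ((real L)\<^sup>2 / (2 * s\<^sup>2)))"
        using K s by (simp add: divide_right_mono power_mono)
      also have "\<dots> \<le> 1 / ((real L)\<^sup>2 / (2 * s\<^sup>2))"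
        using s L by (intro exp_minus_le_inverse) auto
      finally have "exp (- (real K - narayana_mean n)\<^sup>2 / (2 * s\<^sup>2)) \<le> 2 * s\<^sup>2 / (real L)\<^sup>2" by simp
      then have "1 / s * exp (- (real K - narayana_mean n)\<^sup>2 / (2 * s\<^sup>2)) \<le> 1 / s * (2 * s\<^sup>2 / (real L)\<^sup>2)"
        using s by (intro mult_left_mono) auto
      with g_max[of "real K"] show ?thesis by linarith
    qed
    have gK_B: "narayana_gauss n (real K) * exp E \<le> B"
    proof -
      have "narayana_gauss n (real K) * exp E \<le> 1 / s * (2 * s\<^sup>2 / (real L)\<^sup>2) * exp E"
        using gK by (rule mult_right_mono) simp
      also have "\<dots> = exp E / s * (2 * s\<^sup>2 / (real L)\<^sup>2)" by simp
      also have "\<dots> \<le> B" unfolding B_def using s E0 by (intro mult_left_mono) auto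
      finally show ?thesis .
    qed
    have "narayana_gauss n (real k) \<le> narayana_gauss n (real K)"
      using K n by (intro narayana_gauss_antimono) auto
    also have "\<dots> \<le> narayana_gauss n (real K) * exp E"
      using g0 E0 by simp
    finally have g_B: "narayana_gauss n (real k) \<le> B" using gK_B by simp
    have "narayana_mass n (int k) \<le> narayana_mass n (int K)"
      using K n by (intro narayana_mass_antimono) (auto simp: K_def mid_def)
    also have "\<dots> \<le> narayana_gauss n (real K) * exp E"
      unfolding u(2) using g0 u(1) by simp
    finally have "narayana_mass n (int k) \<le> B" using gK_B by simp
    then show ?thesis
      using g_B g0[of "real k"] narayana_mass_nonneg[of n "int k"] by linarith
  qed
  have "\<bar>narayana_mass n j - narayana_gauss n (real_of_int j)\<bar> \<le> B"
  proof (cases "int mid \<le> j")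
    case True
    define k where "k = nat j"
    have k: "j = int k" "mid \<le> k" using True by (auto simp: k_def)
    show ?thesis using upper[OF k(2)] by (simp add: k(1))
  next
    case False
    \<comment> \<open>Here \<open>j <= n div 2\<close>, hence the reflected point is at least
      \<open>n - n div 2 + 1\<close>.\<close>
    then have *: "int mid \<le> int n + 1 - j" by (auto simp: mid_def)
    define k where "k = nat (int n + 1 - j)"
    have k: "int n + 1 - j = int k" "mid \<le> k"
      using * by (auto simp: k_def)
    have "real k = real n + 1 - real_of_int j" using k(1) by linarith
    then show ?thesis
      using upper[OF k(2)] narayana_mass_reflect[of n j] narayana_gauss_reflect[of n "real_of_int j"]
      unfolding k(1) by simp
  qed
  then show ?thesis by (simp only: B_def s_def)
qed

section \<open>Asymptotic size of the errors\<close>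

text \<open>Since \<sigma> squared is \<open>n/8 + O(1)\<close>, the arguments of both logarithms
  are \<open>1 + O(1/n)\<close>, so all three terms are in fact \<open>O(1/n)\<close>.\<close>

lemma mid_error_bigo: "mid_error \<in> O(\<lambda>n. real n powr (- 1 / 4))"
proof -
  have "(\<lambda>n. ln (narayana_sd n * sqrt (8 * real n + 4) / real n)) \<in> O(\<lambda>n. real n powr (- 1 / 4))"
    unfolding narayana_sd_def real_sqrt_mult[symmetric] by real_asymp
  moreover have "(\<lambda>n. ln (narayana_sd n * sqrt (8 * real n) / (real n + 2))) \<in> O(\<lambda>n. real n powr (- 1 / 4))"
    unfolding narayana_sd_def real_sqrt_mult[symmetric] by real_asymp
  moreover have "(\<lambda>n. 1 / (8 * (narayana_sd n)\<^sup>2)) \<in> O(\<lambda>n. real n powr (- 1 / 4))"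
    unfolding narayana_sd_def by real_asymp
  ultimately show ?thesis
    unfolding mid_error_def[abs_def] by (intro sum_in_bigo) auto
qed

text \<open>With \<open>L\<close> about \<open>n powr (5/8)\<close> the drift terms are of order
  \<open>n powr (-3/4)\<close> and \<open>n powr (-1/2)\<close>, and the tail term
  \<open>\<sigma>^2/L^2\<close> of order \<open>n powr (-1/4)\<close>; a smaller exponent would
  spoil the tail. The real power replaces the integer \<open>L\<close>, and the \<open>- 1\<close>
  allows for rounding.\<close>

definition rel_error :: "nat \<Rightarrow> real" where
  "rel_error n = mid_error n +
     real n powr (5/8) * (8 * real n powr (5/8) / (real n)\<^sup>2 + 96 * (real n powr (5/8)) ^ 3 / (real n) ^ 3) +
     2 * (narayana_sd n)\<^sup>2 / (real n powr (5/8) - 1)\<^sup>2"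

lemma rel_error_bigo: "rel_error \<in> O(\<lambda>n. real n powr (- 1 / 4))"
proof -
  have "(\<lambda>n. real n powr (5/8) * (8 * real n powr (5/8) / (real n)\<^sup>2 + 96 * (real n powr (5/8)) ^ 3 / (real n) ^ 3))
      \<in> O(\<lambda>n. real n powr (- 1 / 4))"
    by real_asymp
  moreover have "(\<lambda>n. 2 * (narayana_sd n)\<^sup>2 / (real n powr (5/8) - 1)\<^sup>2) \<in> O(\<lambda>n. real n powr (- 1 / 4))"
    unfolding narayana_sd_def by real_asymp
  ultimately show ?thesis
    unfolding rel_error_def[abs_def] by (intro sum_in_bigo mid_error_bigo)
qed

lemma local_error_rel_error:
  assumes n: "n \<ge> 2" and X: "2 \<le> real n powr (5/8)" "real n powr (5/8) \<le> real n / 8"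
  shows "\<bar>narayana_mass n j - narayana_gauss n (real_of_int j)\<bar>
    \<le> exp (rel_error n) * rel_error n / narayana_sd n"
proof -
  define X where "X = real n powr (5/8)"
  \<comment> \<open>Rounding down lets \<open>X\<close> bound the drift terms and
    \<open>X - 1\<close> the tail denominator, positive because \<open>X >= 2\<close>.\<close>
  define L where "L = nat \<lfloor>X\<rfloor>"
  define s where "s = narayana_sd n"
  define E where "E = mid_error n + real L * (8 * real L / (real n)\<^sup>2 + 96 * real L ^ 3 / (real n) ^ 3)"
  have s: "s > 0" using narayana_sd_pos[OF n] by (simp add: s_def)
  have X2: "X \<ge> 2" using X by (simp add: X_def)
  have L: "X - 1 \<le> real L" "real L \<le> X" "1 \<le> L" using X2 unfolding L_def by linarith+
  have E0: "E \<ge> 0" by (simp add: E_def mid_error_def)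
  have "real L * (8 * real L / (real n)\<^sup>2 + 96 * real L ^ 3 / (real n) ^ 3) \<le>
      X * (8 * X / (real n)\<^sup>2 + 96 * X ^ 3 / (real n) ^ 3)"
    using L X2 by (intro mult_mono add_mono divide_right_mono mult_left_mono power_mono) auto
  moreover have "2 * s\<^sup>2 / (real L)\<^sup>2 \<le> 2 * s\<^sup>2 / (X - 1)\<^sup>2"
    using L X2 by (intro divide_left_mono power_mono) auto
  ultimately have W: "E + 2 * s\<^sup>2 / (real L)\<^sup>2 \<le> rel_error n"
    unfolding E_def rel_error_def X_def s_def by linarith
  moreover have "2 * s\<^sup>2 / (real L)\<^sup>2 \<ge> 0" by simp
  ultimately have E_W: "E \<le> rel_error n" by linarith
  have "\<bar>narayana_mass n j - narayana_gauss n (real_of_int j)\<bar> \<le> exp E / s * (E + 2 * s\<^sup>2 / (real L)\<^sup>2)"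
    using narayana_local_error[OF n L(3), of j] L(2) X(2) unfolding E_def s_def X_def by linarith
  also have "\<dots> \<le> exp (rel_error n) / s * rel_error n"
    using W E_W E0 s by (intro mult_mono divide_right_mono) auto
  finally show ?thesis by (simp add: s_def)
qed

section \<open>Passage to a universal constant\<close>

theorem corollary1p4:
  shows "\<exists>C::real. \<forall>n::nat. n \<ge> 2 \<longrightarrow>
    sqrt (narayana_sd n) *
      (SUP k::int. \<bar>pmf (narayana_pmf n) k
         - 1 / narayana_sd n * std_normal_density ((real_of_int k - narayana_mean n) / narayana_sd n)\<bar>)
    \<le> C / sqrt (real n)"
proof -
  define F where "F n = sqrt (narayana_sd n) *
      (SUP k::int. \<bar>pmf (narayana_pmf n) k
         - 1 / narayana_sd n * std_normal_density ((real_of_int k - narayana_mean n) / narayana_sd n)\<bar>)" for n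
  obtain c where c: "c > 0" "\<forall>\<^sub>F n in sequentially. norm (rel_error n) \<le> c * norm (real n powr (- 1 / 4))"
    using rel_error_bigo by (elim landau_o.bigE)
  have "\<forall>\<^sub>F n in sequentially. 2 \<le> real n powr (5/8) \<and> real n powr (5/8) \<le> real n / 8"
    by (intro eventually_conj; real_asymp)
  with c(2) have "\<forall>\<^sub>F n in sequentially. n \<ge> 2 \<longrightarrow> F n \<le> (2 * c * exp c) / sqrt (real n)"
  proof eventually_elim
    case (elim n)
    show ?case
    proof
      assume n: "n \<ge> 2"
      define s where "s = narayana_sd n"
      define r where "r = rel_error n"
      have s: "s > 0" using narayana_sd_pos[OF n] by (simp add: s_def)
      have r0: "r \<ge> 0" by (simp add: r_def rel_error_def mid_error_def)
      have r: "r \<le> c * real n powr (- 1 / 4)" using elim(1) by (simp add: r_def)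
      \<comment> \<open>Boundedness of \<open>r\<close> turns the factor \<open>exp r\<close> into
        the constant \<open>exp c\<close>.\<close>
      also have "\<dots> \<le> c * 1" using powr_mono[of "- 1 / 4" 0 "real n"] n c(1) by (intro mult_left_mono) auto
      finally have r1: "r \<le> c" by simp
      have "(SUP k::int. \<bar>pmf (narayana_pmf n) k
         - 1 / narayana_sd n * std_normal_density ((real_of_int k - narayana_mean n) / narayana_sd n)\<bar>)
         \<le> exp r * r / s"
        using local_error_rel_error[OF n] elim(2) n
        by (intro cSUP_least) (auto simp: pmf_narayana_pmf narayana_gauss_def r_def s_def)
      then have "F n \<le> sqrt s * (exp r * r / s)"
        unfolding F_def s_def[symmetric] using s by (intro mult_left_mono) auto
      also have "\<dots> = exp r * r / sqrt s"
        using s by (simp add: field_simps)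
      \<comment> \<open>One factor \<open>n powr (-1/4)\<close> comes from \<open>r\<close>, the
        other from \<open>1 / sqrt \<sigma>\<close>; together they give the rate
        \<open>1 / sqrt n\<close>.\<close>
      also have "\<dots> \<le> exp c * (c * real n powr (- 1 / 4)) / (real n powr (1 / 4) / 2)"
      proof (rule frac_le)
        have "real n / 16 \<le> s\<^sup>2"
        proof -
          \<comment> \<open>A quarter of the difference of the two sides of the next
            inequality.\<close>
          have "0 \<le> (real n - 2) * (2 * real n + 5) + 6" using n by simp
          then have "real n * (4 * (2 * real n - 1)) \<le> 16 * ((real n - 1) * (real n + 1))"
            by (simp add: algebra_simps)
          then show ?thesis
            unfolding s_def narayana_sd_sq[OF n] using n by (simp add: divide_simps mult_ac)
        qed
        then have "sqrt (real n / 16) \<le> s" using s by (intro real_le_lsqrt) auto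
        then have "sqrt (sqrt (real n / 16)) \<le> sqrt s" by simp
        moreover have "sqrt (sqrt (real n / 16)) = real n powr (1 / 4) / 2"
          using n by (simp add: real_sqrt_divide powr_half_sqrt[symmetric] powr_powr)
        ultimately show "real n powr (1 / 4) / 2 \<le> sqrt s" by simp
      qed (use n c(1) r0 r r1 in \<open>auto intro!: mult_mono\<close>)
      also have "\<dots> = (2 * c * exp c) / sqrt (real n)"
        using n by (simp add: powr_half_sqrt[symmetric] field_simps flip: powr_add)
      finally show "F n \<le> (2 * c * exp c) / sqrt (real n)" .
    qed
  qed
  then obtain N where N: "\<And>n. n \<ge> N \<Longrightarrow> n \<ge> 2 \<Longrightarrow> F n \<le> (2 * c * exp c) / sqrt (real n)"
    by (auto simp: eventually_sequentially)
  \<comment> \<open>The sum covers the finitely many \<open>n < N\<close> outside the asymptotic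
    range.\<close>
  define C where "C = 2 * c * exp c + (\<Sum>n<N. \<bar>F n * sqrt (real n)\<bar>)"
  have "F n \<le> C / sqrt (real n)" if n: "n \<ge> 2" for n
  proof -
    have "F n * sqrt (real n) \<le> C"
    proof (cases "n < N")
      case True
      then have "\<bar>F n * sqrt (real n)\<bar> \<le> (\<Sum>n<N. \<bar>F n * sqrt (real n)\<bar>)"
        by (intro member_le_sum) auto
      moreover have "2 * c * exp c \<ge> 0" using c(1) by simp
      ultimately show ?thesis unfolding C_def by linarith
    next
      case False
      then have "F n * sqrt (real n) \<le> 2 * c * exp c"
        using N[of n] n by (simp add: pos_le_divide_eq)
      moreover have "(\<Sum>n<N. \<bar>F n * sqrt (real n)\<bar>) \<ge> 0" by (intro sum_nonneg) simp
      ultimately show ?thesis unfolding C_def by linarith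
    qed
    then show ?thesis using n by (simp add: pos_le_divide_eq)
  qed
  then show ?thesis unfolding F_def by blast
qed

end
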